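(* Let $\alpha$ be a plane of a space of incidence. Let $A,B,C$ be three non-collinear points of $\alpha$ and $A',B',C'$ three non-collinear points of $\alpha$ such that $A\neq A'$, $B\neq B'$, $C\neq C'$, and such that the lines $AB\neq A'B'$, $BC\neq B'C'$, $AC\neq A'C'$ are pairwise different as indicated. Let $X=AB\cap A'B'$, $Y=BC\cap B'C'$, $Z=AC\cap A'C'$. Then the lines $AA'$, $BB'$, $CC'$ pass through a common point $S$ if and only if the points $X,Y,Z$ are incident with a common line $s$.
   Context: A space of incidence consists of points, lines and planes with an incidence relation; a line is called incident with a plane if all points of the line are incident with the plane. Points are collinear (coplanar) if they are all incident with one line (one plane). The following axioms hold ("two", "three", etc. mean distinct elements): (S1) Two points uniquely determine a line which is incident with them. (S2) Two planes uniquely determine a line which is incident with them (their line of intersection). (S3) Three non-collinear points uniquely determine a plane incident with them. (S4) Three planes which have no common line uniquely determine a point incident with them. (S5) If two points incident with a line are incident with a plane, then all points of this line are incident with this plane. (S6) If two planes incident with a line are incident with a point, then all planes incident with this line are incident with this point. (S7) In every plane there exist four points, no three of which are collinear. (S8) There exist five points, no four of which are coplanar. Here $PQ$ denotes the line through distinct points $P,Q$, and $l\cap m$ denotes the common point of two distinct coplanar lines $l,m$ (which exists and is unique). *)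

theory Defs
  imports Main
begin

text \<open>
  Points, lines and planes are three abstract sorts (type variables); \<open>on\<close> is incidence of
  points with lines and \<open>onp\<close> is incidence of points with planes.
\<close>

definition line_in_plane :: "('p \<Rightarrow> 'l \<Rightarrow> bool) \<Rightarrow> ('p \<Rightarrow> 'a \<Rightarrow> bool) \<Rightarrow> 'l \<Rightarrow> 'a \<Rightarrow> bool" where
  "line_in_plane on onp l \<alpha> \<longleftrightarrow> (\<forall>P. on P l \<longrightarrow> onp P \<alpha>)"

definition collinear_pts :: "('p \<Rightarrow> 'l \<Rightarrow> bool) \<Rightarrow> 'p set \<Rightarrow> bool" where
  "collinear_pts on T \<longleftrightarrow> (\<exists>l. \<forall>P\<in>T. on P l)"

definition coplanar_pts :: "('p \<Rightarrow> 'a \<Rightarrow> bool) \<Rightarrow> 'p set \<Rightarrow> bool" where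
  "coplanar_pts onp T \<longleftrightarrow> (\<exists>\<alpha>. \<forall>P\<in>T. onp P \<alpha>)"

locale incidence_space =
  fixes on :: "'p \<Rightarrow> 'l \<Rightarrow> bool"
    and onp :: "'p \<Rightarrow> 'a \<Rightarrow> bool"
  assumes S1: "P \<noteq> Q \<Longrightarrow> \<exists>!l. on P l \<and> on Q l"
    and S2: "\<alpha> \<noteq> \<beta> \<Longrightarrow> \<exists>!l. line_in_plane on onp l \<alpha> \<and> line_in_plane on onp l \<beta>"
    and S3: "\<lbrakk>distinct [P, Q, R]; \<not> collinear_pts on {P, Q, R}\<rbrakk>
              \<Longrightarrow> \<exists>!\<alpha>. onp P \<alpha> \<and> onp Q \<alpha> \<and> onp R \<alpha>"
    and S4: "\<lbrakk>distinct [\<alpha>, \<beta>, \<gamma>];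
               \<not> (\<exists>l. line_in_plane on onp l \<alpha> \<and> line_in_plane on onp l \<beta> \<and> line_in_plane on onp l \<gamma>)\<rbrakk>
              \<Longrightarrow> \<exists>!P. onp P \<alpha> \<and> onp P \<beta> \<and> onp P \<gamma>"
    and S5: "\<lbrakk>P \<noteq> Q; on P l; on Q l; onp P \<alpha>; onp Q \<alpha>; on R l\<rbrakk> \<Longrightarrow> onp R \<alpha>"
    and S6: "\<lbrakk>\<alpha> \<noteq> \<beta>; line_in_plane on onp l \<alpha>; line_in_plane on onp l \<beta>; onp P \<alpha>; onp P \<beta>;
               line_in_plane on onp l \<gamma>\<rbrakk> \<Longrightarrow> onp P \<gamma>"
    and S7: "\<exists>Q. card Q = 4 \<and> (\<forall>P\<in>Q. onp P \<alpha>) \<and>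
                 (\<forall>T\<subseteq>Q. card T = 3 \<longrightarrow> \<not> collinear_pts on T)"
    and S8: "\<exists>Q :: 'p set. card Q = 5 \<and> (\<forall>T\<subseteq>Q. card T = 4 \<longrightarrow> \<not> coplanar_pts onp T)"

text \<open>Meaningful only for \<open>P \<noteq> Q\<close>.\<close>

definition join :: "('p \<Rightarrow> 'l \<Rightarrow> bool) \<Rightarrow> 'p \<Rightarrow> 'p \<Rightarrow> 'l" where
  "join on P Q = (THE l. on P l \<and> on Q l)"

text \<open>Meaningful only for distinct coplanar lines \<open>l\<close> and \<open>m\<close>.\<close>

definition meet :: "('p \<Rightarrow> 'l \<Rightarrow> bool) \<Rightarrow> 'l \<Rightarrow> 'l \<Rightarrow> 'p" where
  "meet on l m = (THE P. on P l \<and> on P m)"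

end

theory Submission
  imports Defs
begin

text \<open>
  Both directions lift the configuration out of \<open>\<alpha>\<close>. Given a centre \<open>S\<close> that is not a vertex, take
  \<open>V \<notin> \<alpha>\<close> and a third point \<open>V'\<close> of the line \<open>VS\<close>; the points \<open>A'' = VA \<inter> V'A'\<close>, \<open>B''\<close>, \<open>C''\<close> span
  a plane other than \<open>\<alpha>\<close>, and \<open>A''B''\<close> meets \<open>\<alpha>\<close> in \<open>X\<close>, so \<open>X, Y, Z\<close> lie on the intersection of the
  two planes. If \<open>S\<close> is a vertex, say \<open>S = A\<close>, then \<open>X = B'\<close> and \<open>Z = C'\<close>.

  Given an axis \<open>s\<close>, project \<open>A'B'C'\<close> from a point \<open>V\<close> onto a second plane \<open>\<pi>\<close> through \<open>s\<close>. The
  triangles \<open>ABC\<close> and \<open>A''B''C''\<close> have sides that meet on \<open>s\<close>, so corresponding sides span three planes,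
  and these planes share a point \<open>T\<close> lying on \<open>AA''\<close>, \<open>BB''\<close>, \<open>CC''\<close>. Projecting \<open>T\<close> from \<open>V\<close> back to
  \<open>\<alpha>\<close> gives the centre.
\<close>

context incidence_space
begin

section \<open>Incidence in space\<close>

lemma line_unique: "\<lbrakk>P \<noteq> Q; on P l; on Q l; on P m; on Q m\<rbrakk> \<Longrightarrow> l = m"
  using S1 by blast

lemma line_exists: "P \<noteq> Q \<Longrightarrow> \<exists>l. on P l \<and> on Q l"
  using S1 by blast

lemma line_in_planeI:
  "\<lbrakk>P \<noteq> Q; on P l; on Q l; onp P \<alpha>; onp Q \<alpha>\<rbrakk> \<Longrightarrow> line_in_plane on onp l \<alpha>"
  unfolding line_in_plane_def using S5 by blast

lemma line_in_planeD: "\<lbrakk>line_in_plane on onp l \<alpha>; on P l\<rbrakk> \<Longrightarrow> onp P \<alpha>"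
  unfolding line_in_plane_def by blast

lemma plane_ex1:
  assumes "P \<noteq> Q" "on P l" "on Q l" "\<not> on R l"
  shows "\<exists>!\<alpha>. onp P \<alpha> \<and> onp Q \<alpha> \<and> onp R \<alpha>"
proof (rule S3)
  show "distinct [P, Q, R]" using assms by auto
  show "\<not> collinear_pts on {P, Q, R}"
    unfolding collinear_pts_def using assms line_unique by blast
qed

text \<open>If \<open>R\<close> were off \<open>l\<close>, then \<open>P\<close>, \<open>Q\<close>,
  \<open>R\<close> would determine a single plane, and \<alpha> and \<beta> would coincide.\<close>

lemma planes_common:
  assumes "\<alpha> \<noteq> \<beta>" "P \<noteq> Q" "on P l" "on Q l"
    and "onp P \<alpha>" "onp Q \<alpha>" "onp P \<beta>" "onp Q \<beta>" "onp R \<alpha>" "onp R \<beta>"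
  shows "on R l"
  using plane_ex1[OF assms(2-4), of R] assms by blast

lemma line_plane_unique:
  "\<lbrakk>on P l; on Q l; onp P \<alpha>; onp Q \<alpha>; on R l; \<not> onp R \<alpha>\<rbrakk> \<Longrightarrow> P = Q"
  using S5 by blast

lemma point_off_plane: "\<exists>P. \<not> onp P \<alpha>"
proof (rule ccontr)
  assume all: "\<nexists>P. \<not> onp P \<alpha>"
  obtain F :: "'p set" where F: "card F = 5" "\<forall>T\<subseteq>F. card T = 4 \<longrightarrow> \<not> coplanar_pts onp T"
    using S8 by blast
  obtain T where "T \<subseteq> F" "card T = 4"
    using obtain_subset_with_card_n[of 4 F] F(1) by auto
  then show False using F(2) all unfolding coplanar_pts_def by blast
qed

text \<open>No three of the four points from S7 are collinear, so one of them is off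
  \<open>l\<close> and can be taken as \<open>E\<close>. The triples recorded are those containing
  \<open>E\<close>: they make the lines from \<open>E\<close> to the other three points
  distinct.\<close>

lemma quadrangle_off_line:
  "\<exists>E F G H. onp E \<alpha> \<and> onp F \<alpha> \<and> onp G \<alpha> \<and> onp H \<alpha> \<and> \<not> on E l \<and> distinct [E, F, G, H] \<and>
     (\<forall>m. on E m \<longrightarrow> \<not> (on F m \<and> on G m) \<and> \<not> (on F m \<and> on H m) \<and> \<not> (on G m \<and> on H m))"
proof -
  obtain Q where Q: "card Q = 4" "\<forall>P\<in>Q. onp P \<alpha>"
    "\<forall>T\<subseteq>Q. card T = 3 \<longrightarrow> \<not> collinear_pts on T"
    using S7[of \<alpha>] by blast
  obtain T where T: "T \<subseteq> Q" "card T = 3"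
    using obtain_subset_with_card_n[of 3 Q] Q(1) by auto
  then obtain E where E: "E \<in> Q" "\<not> on E l"
    using Q(3) unfolding collinear_pts_def by blast
  have "card (Q - {E}) = 3" using Q(1) E(1) by simp
  then obtain F G H where FGH: "Q - {E} = {F, G, H}" "F \<noteq> G" "G \<noteq> H" "F \<noteq> H"
    by (auto simp: card_3_iff)
  then have d: "distinct [E, F, G, H]" and "F \<in> Q" "G \<in> Q" "H \<in> Q" by auto
  have tri: "\<not> (on E m \<and> on U m \<and> on W m)"
    if "U \<in> Q" "W \<in> Q" "U \<noteq> E" "W \<noteq> E" "U \<noteq> W" for U W m
  proof -
    have "{E, U, W} \<subseteq> Q" "card {E, U, W} = 3" using that E(1) by auto
    then show ?thesis using Q(3) unfolding collinear_pts_def by blast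
  qed
  have "\<forall>m. on E m \<longrightarrow> \<not> (on F m \<and> on G m) \<and> \<not> (on F m \<and> on H m) \<and> \<not> (on G m \<and> on H m)"
    using tri d \<open>F \<in> Q\<close> \<open>G \<in> Q\<close> \<open>H \<in> Q\<close> by auto
  then show ?thesis using d E Q(2) \<open>F \<in> Q\<close> \<open>G \<in> Q\<close> \<open>H \<in> Q\<close> by blast
qed

lemma plane_through:
  assumes "P \<noteq> Q" "on P l" "on Q l"
  shows "\<exists>\<beta>. line_in_plane on onp l \<beta> \<and> onp R \<beta>"
proof -
  \<comment> \<open>When \<open>R\<close> lies on \<open>l\<close>, any point off \<open>l\<close>
    can span the plane, which then contains \<open>R\<close> anyway.\<close>
  obtain R' where R': "\<not> on R' l" "\<not> on R l \<Longrightarrow> R' = R"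
    using quadrangle_off_line[of _ l] by blast
  obtain \<beta> where "onp P \<beta>" "onp Q \<beta>" "onp R' \<beta>"
    using plane_ex1[OF assms R'(1)] by blast
  then show ?thesis
    using line_in_planeI[OF assms] line_in_planeD R'(2) by metis
qed

text \<open>Unless \<open>l\<close> lies in \<pi>, S4 applied to \<pi> and two planes through
  \<open>l\<close> gives a point. It lies on \<open>l\<close>, the intersection of those two
  planes.\<close>

lemma line_meets_plane:
  assumes "P \<noteq> Q" "on P l" "on Q l"
  shows "\<exists>R. on R l \<and> onp R \<pi>"
proof (cases "line_in_plane on onp l \<pi>")
  case True
  then show ?thesis using assms line_in_planeD by blast
next
  case False
  obtain \<beta> where \<beta>: "line_in_plane on onp l \<beta>" using plane_through[OF assms] by blast
  obtain V where V: "\<not> onp V \<beta>" using point_off_plane by blast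
  obtain \<gamma> where \<gamma>: "line_in_plane on onp l \<gamma>" "onp V \<gamma>" using plane_through[OF assms] by blast
  have d: "distinct [\<beta>, \<gamma>, \<pi>]" using \<beta> \<gamma> V False by auto
  then have "\<not> (\<exists>n. line_in_plane on onp n \<beta> \<and> line_in_plane on onp n \<gamma> \<and> line_in_plane on onp n \<pi>)"
    using S2[of \<beta> \<gamma>] \<beta> \<gamma> False by auto
  from S4[OF d this] obtain R where R: "onp R \<beta>" "onp R \<gamma>" "onp R \<pi>" by blast
  have "on R l"
  proof (rule planes_common[of \<beta> \<gamma>, OF _ assms])
    show "\<beta> \<noteq> \<gamma>" using d by simp
  qed (use R \<beta> \<gamma> assms line_in_planeD in blast)+
  then show ?thesis using R by blast
qed

text \<open>A second plane \<beta> through \<open>m\<close> reduces this to a line meeting a plane: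
  the point where \<open>l\<close> meets \<beta> lies in both \<alpha> and \<beta>, hence on
  \<open>m\<close>.\<close>

lemma coplanar_lines_meet:
  assumes "P \<noteq> Q" "on P l" "on Q l" "P' \<noteq> Q'" "on P' m" "on Q' m"
    and "onp P \<alpha>" "onp Q \<alpha>" "onp P' \<alpha>" "onp Q' \<alpha>"
  shows "\<exists>R. on R l \<and> on R m"
proof -
  obtain V where V: "\<not> onp V \<alpha>" using point_off_plane by blast
  obtain \<beta> where \<beta>: "line_in_plane on onp m \<beta>" "onp V \<beta>"
    using plane_through[OF assms(4-6)] by blast
  obtain R where R: "on R l" "onp R \<beta>" using line_meets_plane[OF assms(1-3)] by blast
  have "onp R \<alpha>" using S5 assms R by blast
  have "on R m"
  proof (rule planes_common[of \<alpha> \<beta>, OF _ assms(4-6)])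
    show "\<alpha> \<noteq> \<beta>" using V \<beta> by blast
  qed (use R \<open>onp R \<alpha>\<close> \<beta> assms line_in_planeD in blast)+
  then show ?thesis using R by blast
qed

text \<open>Projecting three points of a quadrangle from its fourth point \<open>E\<close>, which is
  off \<open>l\<close>, gives three points of \<open>l\<close>. At most two of them are
  \<open>P\<close> and \<open>Q\<close>.\<close>

lemma third_point:
  assumes "P \<noteq> Q" "on P l" "on Q l"
  shows "\<exists>R. on R l \<and> R \<noteq> P \<and> R \<noteq> Q"
proof -
  obtain \<beta> where \<beta>: "line_in_plane on onp l \<beta>" using plane_through[OF assms] by blast
  have P\<beta>: "onp P \<beta>" "onp Q \<beta>" using \<beta> assms line_in_planeD by blast+
  obtain E F G H where E: "onp E \<beta>" "onp F \<beta>" "onp G \<beta>" "onp H \<beta>" "\<not> on E l"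
    and d: "distinct [E, F, G, H]"
    and nc: "\<And>m. on E m \<Longrightarrow> \<not> (on F m \<and> on G m) \<and> \<not> (on F m \<and> on H m) \<and> \<not> (on G m \<and> on H m)"
    using quadrangle_off_line[of \<beta> l] by blast
  have meet: "\<exists>m U. on E m \<and> on W m \<and> on U m \<and> on U l" if W: "W \<noteq> E" "onp W \<beta>" for W
  proof -
    obtain m where m: "on E m" "on W m" using line_exists[OF W(1)] by blast
    show ?thesis
      using coplanar_lines_meet[OF assms W(1) m(2,1) P\<beta> W(2) E(1)] m by blast
  qed
  obtain f u where f: "on E f" "on F f" "on u f" "on u l" using meet[of F] d E by auto
  obtain g v where g: "on E g" "on G g" "on v g" "on v l" using meet[of G] d E by auto
  obtain h w where h: "on E h" "on H h" "on w h" "on w l" using meet[of H] d E by auto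
  have "f \<noteq> g" "f \<noteq> h" "g \<noteq> h" using nc f g h by blast+
  \<comment> \<open>If two projections coincided, two different lines would share that point and
    \<open>E\<close>, which is off \<open>l\<close>.\<close>
  then have "u \<noteq> v" "u \<noteq> w" "v \<noteq> w"
    using f g h E(5) line_unique by metis+
  then show ?thesis using f(4) g(4) h(4) by metis
qed

text \<open>Otherwise the two planes would share three non-collinear points of a quadrangle in
  \<alpha>.\<close>

lemma plane_not_subset:
  assumes "\<alpha> \<noteq> \<beta>"
  shows "\<exists>P. onp P \<alpha> \<and> \<not> onp P \<beta>"
proof (rule ccontr)
  assume sub: "\<nexists>P. onp P \<alpha> \<and> \<not> onp P \<beta>"
  obtain E F G H where E: "onp E \<alpha>" "onp F \<alpha>" "onp G \<alpha>" "distinct [E, F, G, H]"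
    and nc: "\<And>m. on E m \<Longrightarrow> \<not> (on F m \<and> on G m)"
    using quadrangle_off_line[of \<alpha>] by blast
  then have "E \<noteq> F" by simp
  then obtain m where m: "on E m" "on F m" using line_exists by blast
  have "on G m" using planes_common[OF assms \<open>E \<noteq> F\<close> m] E sub by blast
  then show False using nc m by blast
qed

text \<open>Join a point only in \<alpha> to a point only in \<beta>. The joining line meets each
  plane once, so its third point is in neither.\<close>

lemma point_off_two_planes:
  assumes "\<alpha> \<noteq> \<beta>"
  shows "\<exists>P. \<not> onp P \<alpha> \<and> \<not> onp P \<beta>"
proof -
  obtain P Q where P: "onp P \<alpha>" "\<not> onp P \<beta>" and Q: "onp Q \<beta>" "\<not> onp Q \<alpha>"
    using plane_not_subset assms by metis
  then have "P \<noteq> Q" by blast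
  then obtain l where l: "on P l" "on Q l" using line_exists by blast
  obtain R where R: "on R l" "R \<noteq> P" "R \<noteq> Q" using third_point[OF \<open>P \<noteq> Q\<close> l] by blast
  have "\<not> onp R \<alpha>" "\<not> onp R \<beta>" using R l P Q line_plane_unique by metis+
  then show ?thesis by blast
qed

lemma plane_of_crossing_lines:
  assumes "P \<noteq> Q" "on P l" "on Q l" "P' \<noteq> Q'" "on P' m" "on Q' m" "on X l" "on X m"
  shows "\<exists>\<beta>. line_in_plane on onp l \<beta> \<and> line_in_plane on onp m \<beta>"
proof -
  obtain R where R: "on R m" "R \<noteq> X" using assms by blast
  obtain \<beta> where \<beta>: "line_in_plane on onp l \<beta>" "onp R \<beta>"
    using plane_through[OF assms(1-3)] by blast
  then have "onp X \<beta>" using assms line_in_planeD by blast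
  then have "line_in_plane on onp m \<beta>"
    using line_in_planeI[OF R(2,1) assms(8)] \<beta> by blast
  then show ?thesis using \<beta> by blast
qed

section \<open>The operations \<open>join\<close> and \<open>meet\<close>\<close>

lemma join_on: "P \<noteq> Q \<Longrightarrow> on P (join on P Q) \<and> on Q (join on P Q)"
  unfolding join_def by (rule theI') (rule S1)

lemma meet_on:
  assumes "l \<noteq> m" "\<exists>P. on P l \<and> on P m"
  shows "on (meet on l m) l \<and> on (meet on l m) m"
  unfolding meet_def
proof (rule theI')
  show "\<exists>!P. on P l \<and> on P m" using assms line_unique by blast
qed

section \<open>From the centre to the axis\<close>

text \<open>The plane through \<open>p\<close> and \<open>V\<close> contains \<open>S\<close>, hence
  \<open>V'\<close>, so it contains both lines \<open>VA\<close> and \<open>V'A'\<close>; they meet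
  in the lifted vertex.\<close>

lemma lift_vertex:
  assumes V: "\<not> onp V \<alpha>" "on V g" "on S g" "on V' g" "V' \<noteq> V" "V' \<noteq> S" "onp S \<alpha>"
    and A: "onp A \<alpha>" "onp A' \<alpha>" "A \<noteq> A'" "S \<noteq> A" "S \<noteq> A'"
    and p: "on S p" "on A p" "on A' p"
  shows "\<exists>A'' k k'. on V k \<and> on A k \<and> on A'' k \<and> on V' k' \<and> on A' k' \<and> on A'' k'
           \<and> A'' \<noteq> V \<and> \<not> onp A'' \<alpha>"
proof -
  have V': "\<not> onp V' \<alpha>" using V line_plane_unique by metis
  have ne: "V \<noteq> A" "V' \<noteq> A'" using V V' A by blast+
  obtain k where k: "on V k" "on A k" using line_exists ne by blast
  obtain k' where k': "on V' k'" "on A' k'" using line_exists ne by blast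
  obtain \<beta> where \<beta>: "line_in_plane on onp p \<beta>" "onp V \<beta>"
    using plane_through[OF A(4) p(1,2)] by blast
  have in\<beta>: "onp S \<beta>" "onp A \<beta>" "onp A' \<beta>" using \<beta> p line_in_planeD by blast+
  have "V \<noteq> S" using V by blast
  then have "onp V' \<beta>" using S5 V \<beta>(2) in\<beta>(1) by blast
  then obtain A'' where A'': "on A'' k" "on A'' k'"
    using coplanar_lines_meet[OF ne(1) k ne(2) k' \<beta>(2) in\<beta>(2) _ in\<beta>(3)] by blast
  have "A'' \<noteq> V"
  proof
    assume "A'' = V"
    \<comment> \<open>The line \<open>g\<close> would then meet \<alpha> in both \<open>S\<close>
      and \<open>A'\<close>, forcing \<open>S = A'\<close>.\<close>
    then have "k' = g" using line_unique[of V V'] V A'' k' by blast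
    then show False using line_plane_unique[of S g A' \<alpha> V] V A k' by blast
  qed
  \<comment> \<open>Each of \<open>k\<close> and \<open>k'\<close> meets \<alpha> only once, in
    \<open>A\<close> and in \<open>A'\<close> respectively.\<close>
  moreover have "\<not> onp A'' \<alpha>"
  proof
    assume "onp A'' \<alpha>"
    then have "A'' = A" "A'' = A'"
      using line_plane_unique A'' k k' V V' A by metis+
    then show False using A by blast
  qed
  ultimately show ?thesis using A'' k k' by blast
qed

text \<open>The line \<open>A''B''\<close> lies in the plane of \<open>V\<close>, \<open>A\<close>,
  \<open>B\<close> and in that of \<open>V'\<close>, \<open>A'\<close>, \<open>B'\<close>. Its point
  in \<alpha> is therefore on both \<open>AB\<close> and \<open>A'B'\<close>, which makes it
  \<open>X\<close>.\<close>

lemma lifted_side: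
  assumes V: "\<not> onp V \<alpha>" "\<not> onp V' \<alpha>"
    and AB: "onp A \<alpha>" "onp B \<alpha>" "onp A' \<alpha>" "onp B' \<alpha>" "A \<noteq> B" "A' \<noteq> B'"
    and c: "on A c" "on B c" "on A' c'" "on B' c'" "c \<noteq> c'" "on X c" "on X c'"
    and k: "on V k" "on A k" "on A'' k" "on V' k'" "on A' k'" "on A'' k'" "A'' \<noteq> V"
    and h: "on V h" "on B h" "on B'' h" "on V' h'" "on B' h'" "on B'' h'"
  shows "A'' \<noteq> B'' \<and> (\<forall>n. on A'' n \<longrightarrow> on B'' n \<longrightarrow> on X n)"
proof
  show ne: "A'' \<noteq> B''"
  proof
    assume "A'' = B''"
    then have "k = h" using line_unique k h by blast
    then show False using line_plane_unique[of A k B \<alpha> V] k h V AB by blast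
  qed
  show "\<forall>n. on A'' n \<longrightarrow> on B'' n \<longrightarrow> on X n"
  proof (intro allI impI)
    fix n assume n: "on A'' n" "on B'' n"
    obtain U where U: "on U n" "onp U \<alpha>" using line_meets_plane[OF ne n] by blast
    \<comment> \<open>The centre \<open>W\<close> is kept general to serve \<open>V\<close> with
      side \<open>c\<close> and \<open>V'\<close> with side \<open>c'\<close>.\<close>
    have on_side: "on U d"
      if prem: "\<not> onp W \<alpha>" "onp P \<alpha>" "onp Q \<alpha>" "P \<noteq> Q" "on P d" "on Q d"
        "on W i" "on P i" "on A'' i" "on W j" "on Q j" "on B'' j" for W P Q d i j
    proof -
      obtain \<beta> where \<beta>: "line_in_plane on onp d \<beta>" "onp W \<beta>"
        using plane_through prem by metis
      have PQ: "onp P \<beta>" "onp Q \<beta>" using \<beta> prem line_in_planeD by blast+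
      have "W \<noteq> P" "W \<noteq> Q" using prem by blast+
      then have "onp A'' \<beta>" "onp B'' \<beta>" using S5 prem \<beta>(2) PQ by metis+
      then have "onp U \<beta>" using S5[OF ne n _ _ U(1)] by blast
      moreover have "\<alpha> \<noteq> \<beta>" using prem \<beta> by blast
      ultimately show ?thesis
        using planes_common[of \<alpha> \<beta> P Q d U] prem PQ U by blast
    qed
    have "on U c" using on_side[OF V(1) AB(1,2,5) c(1,2) k(1-3) h(1-3)] .
    moreover have "on U c'" using on_side[OF V(2) AB(3,4,6) c(3,4) k(4-6) h(4-6)] .
    ultimately have "U = X" using c line_unique by blast
    then show "on X n" using U by blast
  qed
qed

text \<open>When the centre is \<open>A\<close>, the line \<open>BB'\<close> is \<open>AB\<close>
  itself, so \<open>B'\<close> lies on both \<open>c\<close> and \<open>c'\<close> and equals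
  \<open>X\<close>. Likewise \<open>Z = C'\<close>, and the axis is \<open>a'\<close>.\<close>

lemma axis_of_vertex_centre:
  assumes ne: "A \<noteq> B" "A \<noteq> C"
    and lines: "on A c" "on B c" "on A b" "on C b" "on A' c'" "on B' c'" "on A' b'" "on C' b'"
      "on B' a'" "on C' a'"
    and ne_lines: "b \<noteq> b'" "c \<noteq> c'"
    and X: "on X c" "on X c'" and Y: "on Y a'" and Z: "on Z b" "on Z b'"
    and q: "on B q" "on B' q" "on A q" and r: "on C r" "on C' r" "on A r"
  shows "\<exists>s. on X s \<and> on Y s \<and> on Z s"
proof -
  have "q = c" "r = b" using line_unique ne lines q r by metis+
  then have "X = B'" "Z = C'" using line_unique lines ne_lines X Z q r by metis+
  then show ?thesis using lines Y by blast
qed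

text \<open>The points \<open>X\<close>, \<open>Y\<close>, \<open>Z\<close> lie in \<alpha> on the
  sides and in \<pi> on the lifted sides. As \<open>A''\<close> is off \<alpha>, the planes differ
  and meet in the line \<open>XY\<close>.\<close>

lemma axis_of_general_centre:
  assumes pts: "onp A \<alpha>" "onp B \<alpha>" "onp C \<alpha>" "onp A' \<alpha>" "onp B' \<alpha>" "onp C' \<alpha>" "onp S \<alpha>"
    and ne: "A \<noteq> B" "B \<noteq> C" "A \<noteq> C" "A' \<noteq> B'" "B' \<noteq> C'" "A' \<noteq> C'" "A \<noteq> A'" "B \<noteq> B'" "C \<noteq> C'"
    and sides: "on B a" "on C a" "on A b" "on C b" "on A c" "on B c"
      "on B' a'" "on C' a'" "on A' b'" "on C' b'" "on A' c'" "on B' c'"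
    and ne_sides: "a \<noteq> a'" "b \<noteq> b'" "c \<noteq> c'"
    and XYZ: "on X c" "on X c'" "on Y a" "on Y a'" "on Z b" "on Z b'" "X \<noteq> Y"
    and rays: "on A p" "on A' p" "on S p" "on B q" "on B' q" "on S q" "on C r" "on C' r" "on S r"
    and S: "S \<notin> {A, B, C, A', B', C'}"
  shows "\<exists>s. on X s \<and> on Y s \<and> on Z s"
proof -
  obtain V where V: "\<not> onp V \<alpha>" using point_off_plane by blast
  then have "V \<noteq> S" using pts by blast
  then obtain g where g: "on V g" "on S g" using line_exists by blast
  obtain V' where V': "on V' g" "V' \<noteq> V" "V' \<noteq> S" using third_point[OF \<open>V \<noteq> S\<close> g] by blast
  have "\<not> onp V' \<alpha>" using V V' g pts line_plane_unique by metis
  note lift = lift_vertex[OF V g V' pts(7)]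
  obtain A'' k k' where A: "on V k" "on A k" "on A'' k" "on V' k'" "on A' k'" "on A'' k'"
    "A'' \<noteq> V" "\<not> onp A'' \<alpha>"
    using lift[OF pts(1,4) ne(7) _ _ rays(3,1,2)] S by blast
  obtain B'' h h' where B: "on V h" "on B h" "on B'' h" "on V' h'" "on B' h'" "on B'' h'" "B'' \<noteq> V"
    using lift[OF pts(2,5) ne(8) _ _ rays(6,4,5)] S by blast
  obtain C'' i i' where C: "on V i" "on C i" "on C'' i" "on V' i'" "on C' i'" "on C'' i'"
    using lift[OF pts(3,6) ne(9) _ _ rays(9,7,8)] S by blast
  note side = lifted_side[OF V \<open>\<not> onp V' \<alpha>\<close>]
  have AB: "A'' \<noteq> B''" "\<And>n. \<lbrakk>on A'' n; on B'' n\<rbrakk> \<Longrightarrow> on X n"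
    using side[OF pts(1,2,4,5) ne(1,4) sides(5,6,11,12) ne_sides(3) XYZ(1,2) A(1-7) B(1-6)] by blast+
  have BC: "B'' \<noteq> C''" "\<And>n. \<lbrakk>on B'' n; on C'' n\<rbrakk> \<Longrightarrow> on Y n"
    using side[OF pts(2,3,5,6) ne(2,5) sides(1,2,7,8) ne_sides(1) XYZ(3,4) B(1-7) C] by blast+
  have AC: "A'' \<noteq> C''" "\<And>n. \<lbrakk>on A'' n; on C'' n\<rbrakk> \<Longrightarrow> on Z n"
    using side[OF pts(1,3,4,6) ne(3,6) sides(3,4,9,10) ne_sides(2) XYZ(5,6) A(1-7) C] by blast+
  obtain n where n: "on A'' n" "on B'' n" using line_exists AB(1) by blast
  obtain \<pi> where \<pi>: "line_in_plane on onp n \<pi>" "onp C'' \<pi>"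
    using plane_through[OF AB(1) n] by blast
  have in\<pi>: "onp A'' \<pi>" "onp B'' \<pi>" using \<pi> n line_in_planeD by blast+
  have "onp X \<pi>" using AB n \<pi> line_in_planeD by blast
  moreover have "onp Y \<pi>" using BC in\<pi> \<pi> line_exists S5 by metis
  moreover have "onp Z \<pi>" using AC in\<pi> \<pi> line_exists S5 by metis
  moreover have "onp X \<alpha>" "onp Y \<alpha>" "onp Z \<alpha>"
    using S5[OF ne(1) sides(5,6) pts(1,2) XYZ(1)] S5[OF ne(2) sides(1,2) pts(2,3) XYZ(3)]
      S5[OF ne(3) sides(3,4) pts(1,3) XYZ(5)] by blast+
  moreover have "\<alpha> \<noteq> \<pi>" using A in\<pi> by blast
  moreover obtain s where s: "on X s" "on Y s" using line_exists XYZ(7) by blast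
  ultimately have "on Z s" using planes_common[OF _ XYZ(7) s] by blast
  then show ?thesis using s by blast
qed

section \<open>From the axis to the centre\<close>

text \<open>Only \<open>A'B'C'\<close> is moved. It goes to another plane through \<open>s\<close>,
  so corresponding sides still cross on \<open>s\<close>, while S4 becomes available to produce a
  centre in space.\<close>

lemma centre_of_axis:
  assumes pts: "onp A \<alpha>" "onp B \<alpha>" "onp C \<alpha>" "onp A' \<alpha>" "onp B' \<alpha>" "onp C' \<alpha>"
    and ne: "A \<noteq> B" "B \<noteq> C" "A \<noteq> C" "A' \<noteq> B'" "B' \<noteq> C'" "A' \<noteq> C'" "A \<noteq> A'" "B \<noteq> B'" "C \<noteq> C'"
    and sides: "on B a" "on C a" "on A b" "on C b" "on A c" "on B c"
      "on B' a'" "on C' a'" "on A' b'" "on C' b'" "on A' c'" "on B' c'"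
    and ne_sides: "a \<noteq> a'" "b \<noteq> b'" "c \<noteq> c'"
    and nc: "\<not> on C c" "\<not> on C' c'"
    and XYZ: "on X c" "on X c'" "on Y a" "on Y a'" "on Z b" "on Z b'" "X \<noteq> Y"
    and s: "on X s" "on Y s" "on Z s"
    and rays: "on A p" "on A' p" "on B q" "on B' q" "on C r" "on C' r"
  shows "\<exists>S. on S p \<and> on S q \<and> on S r"
proof -
  have XYZ\<alpha>: "onp X \<alpha>" "onp Y \<alpha>"
    using S5[OF ne(1) sides(5,6) pts(1,2) XYZ(1)] S5[OF ne(2) sides(1,2) pts(2,3) XYZ(3)] by blast+
  \<comment> \<open>Choosing \<open>W\<close> off \<alpha> makes \<pi> a plane through
    \<open>s\<close> different from \<alpha>.\<close>
  obtain W where W: "\<not> onp W \<alpha>" using point_off_plane by blast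
  obtain \<pi> where \<pi>: "line_in_plane on onp s \<pi>" "onp W \<pi>"
    using plane_through[OF XYZ(7) s(1,2)] by blast
  have "\<alpha> \<noteq> \<pi>" using W \<pi> by blast
  have XYZ\<pi>: "onp X \<pi>" "onp Y \<pi>" "onp Z \<pi>" using \<pi> s line_in_planeD by blast+
  obtain V where V: "\<not> onp V \<alpha>" "\<not> onp V \<pi>" using point_off_two_planes[OF \<open>\<alpha> \<noteq> \<pi>\<close>] by blast
  \<comment> \<open>\<open>P''\<close> is the image of \<open>P'\<close> under projection from
    \<open>V\<close> to \<pi>. That it differs from \<open>P\<close> makes the line
    \<open>PP''\<close> well determined.\<close>
  have project: "\<exists>P'' k. on V k \<and> on P' k \<and> on P'' k \<and> onp P'' \<pi> \<and> P'' \<noteq> P"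
    if P: "onp P \<alpha>" "onp P' \<alpha>" "P \<noteq> P'" for P P'
  proof -
    have "V \<noteq> P'" using V P by blast
    then obtain k where k: "on V k" "on P' k" using line_exists by blast
    obtain P'' where P'': "on P'' k" "onp P'' \<pi>" using line_meets_plane[OF \<open>V \<noteq> P'\<close> k] by blast
    have "P'' \<noteq> P" using line_plane_unique[OF P''(1) k(2) _ P(2) k(1) V(1)] P by blast
    then show ?thesis using k P'' by blast
  qed
  obtain A'' i where A: "on V i" "on A' i" "on A'' i" "onp A'' \<pi>" "A'' \<noteq> A"
    using project[OF pts(1,4) ne(7)] by blast
  obtain B'' j where B: "on V j" "on B' j" "on B'' j" "onp B'' \<pi>" "B'' \<noteq> B"
    using project[OF pts(2,5) ne(8)] by blast
  obtain C'' k where C: "on V k" "on C' k" "on C'' k" "onp C'' \<pi>" "C'' \<noteq> C"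
    using project[OF pts(3,6) ne(9)] by blast
  \<comment> \<open>Equal images would make the two projecting lines one line meeting \<alpha> in
    two points, although \<open>V\<close> is off \<alpha>.\<close>
  have distinct_proj: "P'' \<noteq> Q''"
    if "on V k" "on P' k" "on P'' k" "onp P'' \<pi>" "on V h" "on Q' h" "on Q'' h"
      "onp P' \<alpha>" "onp Q' \<alpha>" "P' \<noteq> Q'" for P' Q' P'' Q'' k h
  proof
    assume "P'' = Q''"
    moreover have "P'' \<noteq> V" using that V by blast
    ultimately have "k = h" using line_unique that by blast
    then show False using line_plane_unique that V by metis
  qed
  have AB: "A'' \<noteq> B''" using distinct_proj[OF A(1-4) B(1-3) pts(4,5) ne(4)] .
  have BC: "B'' \<noteq> C''" using distinct_proj[OF B(1-4) C(1-3) pts(5,6) ne(5)] .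
  have AC: "A'' \<noteq> C''" using distinct_proj[OF A(1-4) C(1-3) pts(4,6) ne(6)] .
  \<comment> \<open>The plane \<delta> through \<open>V\<close> and \<open>P'Q'\<close> meets \<pi>
    in \<open>P''Q''\<close>. The axis point \<open>U\<close> is in both planes, so
    \<open>PQ\<close> and \<open>P''Q''\<close> cross there and span a plane.\<close>
  have side_plane: "\<exists>\<beta>. onp P \<beta> \<and> onp Q \<beta> \<and> onp P'' \<beta> \<and> onp Q'' \<beta>"
    if PQ: "P \<noteq> Q" "on P d" "on Q d" "on U d"
      "P' \<noteq> Q'" "on P' d'" "on Q' d'" "on U d'" "onp U \<pi>" "onp P' \<alpha>" "onp Q' \<alpha>"
      "on V k" "on P' k" "on P'' k" "onp P'' \<pi>" "on V h" "on Q' h" "on Q'' h" "onp Q'' \<pi>" "P'' \<noteq> Q''"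
    for P Q P' Q' P'' Q'' d d' k h U
  proof -
    obtain \<delta> where \<delta>: "line_in_plane on onp d' \<delta>" "onp V \<delta>"
      using plane_through[OF PQ(5-7)] by blast
    have in\<delta>: "onp P' \<delta>" "onp Q' \<delta>" "onp U \<delta>" using \<delta> PQ line_in_planeD by blast+
    have "V \<noteq> P'" "V \<noteq> Q'" using V PQ by blast+
    then have "onp P'' \<delta>" "onp Q'' \<delta>" using S5 PQ \<delta>(2) in\<delta> by metis+
    obtain n where n: "on P'' n" "on Q'' n" using line_exists PQ(20) by blast
    have "\<pi> \<noteq> \<delta>" using V \<delta> by blast
    then have "on U n"
      using planes_common[OF _ PQ(20) n] PQ in\<delta> \<open>onp P'' \<delta>\<close> \<open>onp Q'' \<delta>\<close> by blast
    then obtain \<beta> where "line_in_plane on onp d \<beta>" "line_in_plane on onp n \<beta>"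
      using plane_of_crossing_lines[OF PQ(1-3,20) n PQ(4)] by blast
    then show ?thesis using PQ n line_in_planeD by metis
  qed
  obtain \<gamma> where \<gamma>: "onp A \<gamma>" "onp B \<gamma>" "onp A'' \<gamma>" "onp B'' \<gamma>"
    using side_plane[OF ne(1) sides(5,6) XYZ(1) ne(4) sides(11,12) XYZ(2) XYZ\<pi>(1) pts(4,5)
        A(1-4) B(1-4) AB] by blast
  obtain \<beta> where \<beta>: "onp A \<beta>" "onp C \<beta>" "onp A'' \<beta>" "onp C'' \<beta>"
    using side_plane[OF ne(3) sides(3,4) XYZ(5) ne(6) sides(9,10) XYZ(6) XYZ\<pi>(3) pts(4,6)
        A(1-4) C(1-4) AC] by blast
  obtain \<epsilon> where \<epsilon>: "onp B \<epsilon>" "onp C \<epsilon>" "onp B'' \<epsilon>" "onp C'' \<epsilon>"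
    using side_plane[OF ne(2) sides(1,2) XYZ(3) ne(5) sides(7,8) XYZ(4) XYZ\<pi>(2) pts(5,6)
        B(1-4) C(1-4) BC] by blast
  \<comment> \<open>A plane through all six points would be \<alpha>. The images would then coincide
    with \<open>A'\<close>, \<open>B'\<close>, \<open>C'\<close>, and these non-collinear points
    would lie in both \<alpha> and \<pi>. Hence the three side planes are distinct.\<close>
  have not_all: False if all: "onp A \<delta>" "onp B \<delta>" "onp C \<delta>" "onp A'' \<delta>" "onp B'' \<delta>" "onp C'' \<delta>" for \<delta>
  proof -
    have "\<delta> = \<alpha>" using plane_ex1[OF ne(1) sides(5,6) nc(1)] all pts by blast
    then have "onp A'' \<alpha>" "onp B'' \<alpha>" "onp C'' \<alpha>" using all by auto
    then have eq: "A'' = A'" "B'' = B'" "C'' = C'"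
      using line_plane_unique A B C V pts by metis+
    then have "\<alpha> = \<pi>" using plane_ex1[OF ne(4) sides(11,12) nc(2)] pts A B C by blast
    then show False using \<open>\<alpha> \<noteq> \<pi>\<close> by blast
  qed
  have d: "distinct [\<gamma>, \<beta>, \<epsilon>]" using not_all \<gamma> \<beta> \<epsilon> by auto
  obtain p' q' r' where p': "on A p'" "on A'' p'" and q': "on B q'" "on B'' q'"
    and r': "on C r'" "on C'' r'"
    using line_exists[OF A(5)] line_exists[OF B(5)] line_exists[OF C(5)] by blast
  \<comment> \<open>The side planes intersect pairwise in \<open>p'\<close>, \<open>q'\<close>,
    \<open>r'\<close>. A common line would equal all three and carry \<open>A\<close>,
    \<open>B\<close>, \<open>C\<close>.\<close>
  have "\<not> (\<exists>l. line_in_plane on onp l \<gamma> \<and> line_in_plane on onp l \<beta> \<and> line_in_plane on onp l \<epsilon>)"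
  proof
    assume "\<exists>l. line_in_plane on onp l \<gamma> \<and> line_in_plane on onp l \<beta> \<and> line_in_plane on onp l \<epsilon>"
    then obtain l where l: "line_in_plane on onp l \<gamma>" "line_in_plane on onp l \<beta>"
      "line_in_plane on onp l \<epsilon>" by blast
    have "line_in_plane on onp p' \<gamma>" "line_in_plane on onp p' \<beta>"
      "line_in_plane on onp q' \<gamma>" "line_in_plane on onp q' \<epsilon>"
      "line_in_plane on onp r' \<beta>" "line_in_plane on onp r' \<epsilon>"
      using line_in_planeI A(5) B(5) C(5) p' q' r' \<gamma> \<beta> \<epsilon> by metis+
    moreover have "\<gamma> \<noteq> \<beta>" "\<gamma> \<noteq> \<epsilon>" "\<beta> \<noteq> \<epsilon>" using d by auto
    ultimately have "l = p'" "l = q'" "l = r'" using l S2 by metis+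
    then have "on A l" "on B l" "on C l" using p' q' r' by auto
    then show False using line_unique[OF ne(1)] sides nc(1) by blast
  qed
  from S4[OF d this] obtain T where T: "onp T \<gamma>" "onp T \<beta>" "onp T \<epsilon>" by blast
  have "on T p'" using planes_common[OF _ A(5) p'(2,1)] d \<gamma> \<beta> T by auto
  have "on T q'" using planes_common[OF _ B(5) q'(2,1)] d \<gamma> \<epsilon> T by auto
  have "on T r'" using planes_common[OF _ C(5) r'(2,1)] d \<beta> \<epsilon> T by auto
  \<comment> \<open>Otherwise \<open>p'\<close> is the projecting line \<open>i\<close>, which would
    contain the two points \<open>A\<close> and \<open>A'\<close> of \<alpha> as well as
    \<open>V\<close>.\<close>
  have "T \<noteq> V"
  proof
    assume "T = V"
    moreover have "A'' \<noteq> V" using A V by blast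
    ultimately have "p' = i" using line_unique[of A'' V] A p' \<open>on T p'\<close> by blast
    then show False using line_plane_unique[OF p'(1)] A V pts ne(7) by blast
  qed
  then obtain t where t: "on V t" "on T t" using line_exists by blast
  obtain S where S: "on S t" "onp S \<alpha>" using line_meets_plane[OF \<open>T \<noteq> V\<close> t(2,1)] by blast
  \<comment> \<open>The plane \<delta> through \<open>V\<close> and \<open>w\<close> contains
    \<open>P''\<close> on \<open>VP'\<close>, then \<open>T\<close> on \<open>PP''\<close>, then
    \<open>S\<close> on \<open>VT\<close>. It meets \<alpha> exactly in \<open>w\<close>.\<close>
  have on_ray: "on S w"
    if P: "P \<noteq> P'" "on P w" "on P' w" "onp P \<alpha>" "onp P' \<alpha>" "on V k" "on P' k" "on P'' k"
      "P'' \<noteq> P" "on P w'" "on P'' w'" "on T w'" for P P' P'' w w' k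
  proof -
    obtain \<delta> where \<delta>: "line_in_plane on onp w \<delta>" "onp V \<delta>"
      using plane_through[OF P(1-3)] by blast
    have in\<delta>: "onp P \<delta>" "onp P' \<delta>" using \<delta> P line_in_planeD by blast+
    have "V \<noteq> P'" using V P by blast
    then have "onp P'' \<delta>" using S5 P \<delta>(2) in\<delta> by metis
    then have "onp T \<delta>" using S5 P in\<delta> by metis
    then have "onp S \<delta>" using S5[OF \<open>T \<noteq> V\<close> t(2,1) _ \<delta>(2) S(1)] by blast
    moreover have "\<alpha> \<noteq> \<delta>" using V \<delta> by blast
    ultimately show ?thesis using planes_common[OF _ P(1-3)] P in\<delta> S by blast
  qed
  have "on S p" using on_ray[OF ne(7) rays(1,2) pts(1,4) A(1-3,5) p' \<open>on T p'\<close>] .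
  moreover have "on S q" using on_ray[OF ne(8) rays(3,4) pts(2,5) B(1-3,5) q' \<open>on T q'\<close>] .
  moreover have "on S r" using on_ray[OF ne(9) rays(5,6) pts(3,6) C(1-3,5) r' \<open>on T r'\<close>] .
  ultimately show ?thesis by blast
qed

end

section \<open>Desargues' theorem and its converse for two triangles in one plane\<close>

theorem theorem1:
  fixes on :: "'p \<Rightarrow> 'l \<Rightarrow> bool"
    and onp :: "'p \<Rightarrow> 'a \<Rightarrow> bool"
    and \<alpha> :: 'a
    and A B C A' B' C' X Y Z :: 'p
  assumes "incidence_space on onp"
    and "onp A \<alpha>" "onp B \<alpha>" "onp C \<alpha>"
    and "onp A' \<alpha>" "onp B' \<alpha>" "onp C' \<alpha>"
    and "distinct [A, B, C]" "\<not> collinear_pts on {A, B, C}"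
    and "distinct [A', B', C']" "\<not> collinear_pts on {A', B', C'}"
    and "A \<noteq> A'" "B \<noteq> B'" "C \<noteq> C'"
    and "join on A B \<noteq> join on A' B'"
    and "join on B C \<noteq> join on B' C'"
    and "join on A C \<noteq> join on A' C'"
    and "X = meet on (join on A B) (join on A' B')"
    and "Y = meet on (join on B C) (join on B' C')"
    and "Z = meet on (join on A C) (join on A' C')"
  shows "(\<exists>S. on S (join on A A') \<and> on S (join on B B') \<and> on S (join on C C'))
     \<longleftrightarrow> (\<exists>s. on X s \<and> on Y s \<and> on Z s)"
proof -
  interpret incidence_space on onp by fact
  have ne: "A \<noteq> B" "B \<noteq> C" "A \<noteq> C" "A' \<noteq> B'" "B' \<noteq> C'" "A' \<noteq> C'"
    using assms(8,10) by auto
  define a b c a' b' c' where lines_def: "a = join on B C" "b = join on A C" "c = join on A B"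
    "a' = join on B' C'" "b' = join on A' C'" "c' = join on A' B'"
  define p q r where rays_def: "p = join on A A'" "q = join on B B'" "r = join on C C'"
  note pts = assms(2-7)
  note ne' = assms(12-14)
  have sides: "on B a" "on C a" "on A b" "on C b" "on A c" "on B c"
    "on B' a'" "on C' a'" "on A' b'" "on C' b'" "on A' c'" "on B' c'"
    unfolding lines_def using join_on ne by blast+
  have rays: "on A p" "on A' p" "on B q" "on B' q" "on C r" "on C' r"
    unfolding rays_def using join_on ne' by blast+
  have ne_sides: "a \<noteq> a'" "b \<noteq> b'" "c \<noteq> c'" unfolding lines_def using assms(15-17) by auto
  have nc: "\<not> on C c" "\<not> on C' c'"
    using assms(9,11) sides unfolding collinear_pts_def by blast+
  have "on X c \<and> on X c'"
    unfolding assms(18) lines_def(3,6)[symmetric]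
    using coplanar_lines_meet[OF ne(1) sides(5,6) ne(4) sides(11,12) pts(1,2,4,5)]
    by (rule meet_on[OF ne_sides(3)])
  moreover have "on Y a \<and> on Y a'"
    unfolding assms(19) lines_def(1,4)[symmetric]
    using coplanar_lines_meet[OF ne(2) sides(1,2) ne(5) sides(7,8) pts(2,3,5,6)]
    by (rule meet_on[OF ne_sides(1)])
  moreover have "on Z b \<and> on Z b'"
    unfolding assms(20) lines_def(2,5)[symmetric]
    using coplanar_lines_meet[OF ne(3) sides(3,4) ne(6) sides(9,10) pts(1,3,4,6)]
    by (rule meet_on[OF ne_sides(2)])
  ultimately have XYZ: "on X c" "on X c'" "on Y a" "on Y a'" "on Z b" "on Z b'" by blast+
  \<comment> \<open>A common point of all four lines \<open>a\<close>, \<open>c\<close>,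
    \<open>a'\<close>, \<open>c'\<close> would be both \<open>B\<close> and
    \<open>B'\<close>.\<close>
  have "X \<noteq> Y"
  proof
    assume "X = Y"
    have "a \<noteq> c" "a' \<noteq> c'" using nc sides by blast+
    then have "X = B" "X = B'" using line_unique sides XYZ \<open>X = Y\<close> by metis+
    then show False using ne' by blast
  qed
  have "(\<exists>S. on S p \<and> on S q \<and> on S r) \<longleftrightarrow> (\<exists>s. on X s \<and> on Y s \<and> on Z s)"
  proof
    assume "\<exists>S. on S p \<and> on S q \<and> on S r"
    then obtain S where S: "on S p" "on S q" "on S r" by blast
    have "onp S \<alpha>" using S5[OF ne'(1) rays(1,2) pts(1,4) S(1)] .
    \<comment> \<open>A vertex as centre cannot be lifted. The six such cases are relabellings of
      one lemma, and the primed ones also exchange the triangles.\<close>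
    consider "S = A" | "S = B" | "S = C" | "S = A'" | "S = B'" | "S = C'"
      | "S \<notin> {A, B, C, A', B', C'}" by blast
    then show "\<exists>s. on X s \<and> on Y s \<and> on Z s"
    proof cases
      case 1
      show ?thesis
        using axis_of_vertex_centre[of A B C c b A' c' B' b' C' a' X Y Z q r]
          ne sides ne_sides XYZ rays S 1 by blast
    next
      case 2
      show ?thesis
        using axis_of_vertex_centre[of B A C c a B' c' A' a' C' b' X Z Y p r]
          ne sides ne_sides XYZ rays S 2 by blast
    next
      case 3
      show ?thesis
        using axis_of_vertex_centre[of C A B b a C' b' A' a' B' c' Z X Y p q]
          ne sides ne_sides XYZ rays S 3 by blast
    next
      case 4
      show ?thesis
        using axis_of_vertex_centre[of A' B' C' c' b' A c B b C a X Y Z q r]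
          ne sides ne_sides XYZ rays S 4 by blast
    next
      case 5
      show ?thesis
        using axis_of_vertex_centre[of B' A' C' c' a' B c A a C b X Z Y p r]
          ne sides ne_sides XYZ rays S 5 by blast
    next
      case 6
      show ?thesis
        using axis_of_vertex_centre[of C' A' B' b' a' C b A a B c Z X Y p q]
          ne sides ne_sides XYZ rays S 6 by blast
    next
      case 7
      show ?thesis
        using axis_of_general_centre[OF pts \<open>onp S \<alpha>\<close> ne ne' sides ne_sides XYZ \<open>X \<noteq> Y\<close>
            rays(1,2) S(1) rays(3,4) S(2) rays(5,6) S(3) 7] .
    qed
  next
    assume "\<exists>s. on X s \<and> on Y s \<and> on Z s"
    then obtain s where "on X s" "on Y s" "on Z s" by blast
    then show "\<exists>S. on S p \<and> on S q \<and> on S r"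
      using centre_of_axis[OF pts ne ne' sides ne_sides nc XYZ \<open>X \<noteq> Y\<close> _ _ _ rays] by blast
  qed
  then show ?thesis unfolding rays_def .
qed

end
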